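(* Let $A\in\mathbb{R}^{p\times n}$ be a full-rank matrix and let $Q\in\mathbb{R}^{n\times n}$ be a symmetric matrix that is strictly positive over $\mathrm{null}(A)$, i.e. $u^\top Qu>0$ for all $u\in\mathrm{null}(A)\setminus\{0\}$. If $B\in\mathbb{R}^{n\times n}$ is symmetric positive semidefinite and satisfies, for every $u\in\mathbb{R}^n$, $$u^\top Bu=0\iff u\in\mathrm{null}(A),$$ then there exists $\lambda>0$ such that $Q+\lambda B$ is positive semidefinite. In particular, one can take $B=A^\top SA$ for any symmetric positive definite $S\in\mathbb{R}^{p\times p}$.
   Context: $\mathrm{null}(A)=\{u\in\mathbb{R}^n:\ Au=0\}$. *)

theory Defs
  imports "HOL-Analysis.Analysis"
begin

definition null_space :: "real^'n^'p \<Rightarrow> (real^'n) set" where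
  "null_space A = {u. A *v u = 0}"

definition full_rank :: "real^'n^'p \<Rightarrow> bool" where
  "full_rank A \<longleftrightarrow> rank A = min CARD('p) CARD('n)"

definition symmetric_matrix :: "real^'n^'n \<Rightarrow> bool" where
  "symmetric_matrix M \<longleftrightarrow> transpose M = M"

(* Both definiteness notions include symmetry of the matrix. *)

definition pos_semidef :: "real^'n^'n \<Rightarrow> bool" where
  "pos_semidef M \<longleftrightarrow> symmetric_matrix M \<and> (\<forall>u. u \<bullet> (M *v u) \<ge> 0)"

definition pos_def :: "real^'n^'n \<Rightarrow> bool" where
  "pos_def M \<longleftrightarrow> symmetric_matrix M \<and> (\<forall>u. u \<noteq> 0 \<longrightarrow> u \<bullet> (M *v u) > 0)"

end

theory Submission
  imports Defs
begin

text \<open>Quadratic forms are homogeneous of degree 2, so semidefiniteness of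
  \<open>Q + l *\<^sub>R B\<close> is decided on the unit sphere
  (\<open>pos_semidefI_sphere\<close>), which is compact. There the form of \<open>B\<close> is
  nonnegative, and where it vanishes the form of \<open>Q\<close> is positive, so
  \<open>compact_penalty\<close> yields one multiplier for all unit vectors; this is
  \<open>finsler\<close>. The matrix \<open>A\<close> enters only through the zero set of the form
  of \<open>B\<close>. For \<open>B = transpose A ** S ** A\<close> the form at \<open>u\<close> is
  that of \<open>S\<close> at \<open>A *v u\<close> (\<open>quadratic_form_congruence\<close>),
  which for positive definite \<open>S\<close> vanishes exactly when
  \<open>A *v u = 0\<close>.\<close>

(* On the compact set where f is nonpositive, g has a positive minimum, so a large multiple of g
   outweighs the minimum of f there. *)
lemma compact_penalty:
  fixes f g :: "'a::topological_space \<Rightarrow> real"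
  assumes K: "compact K" and f: "continuous_on K f" and g: "continuous_on K g"
    and g_nonneg: "\<And>x. x \<in> K \<Longrightarrow> g x \<ge> 0"
    and pos: "\<And>x. x \<in> K \<Longrightarrow> g x = 0 \<Longrightarrow> f x > 0"
  shows "\<exists>l>0. \<forall>x\<in>K. f x + l * g x \<ge> 0"
proof (cases "{x\<in>K. f x \<le> 0} = {}")
  case True
  \<comment> \<open>Here \<open>f\<close> is positive on all of \<open>K\<close>, so any positive
    multiplier would do.\<close>
  then have "\<forall>x\<in>K. f x + 1 * g x \<ge> 0"
    using g_nonneg by (force simp: not_le)
  then show ?thesis
    using zero_less_one by blast
next
  case False
  let ?N = "{x\<in>K. f x \<le> 0}"
  have "compact ?N"
  proof -
    \<comment> \<open>The space need not be Hausdorff, so \<open>K\<close> itself may fail to be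
      closed; the sublevel set is compact as a closed set of the whole space cut with
      \<open>K\<close>.\<close>
    obtain T where "closed T" "T \<inter> K = f -` {..0} \<inter> K"
      using f closed_atMost unfolding continuous_on_closed_invariant by blast
    moreover have "?N = f -` {..0} \<inter> K" by auto
    ultimately show ?thesis
      using closed_Int_compact[OF _ K] by metis
  qed
  moreover have "continuous_on ?N f" "continuous_on ?N g"
    using f g by (auto elim: continuous_on_subset)
  ultimately obtain a b where a: "a \<in> ?N" "\<And>x. x \<in> ?N \<Longrightarrow> g a \<le> g x"
    and b: "b \<in> ?N" "\<And>x. x \<in> ?N \<Longrightarrow> f b \<le> f x"
    using continuous_attains_inf[of ?N g] continuous_attains_inf[of ?N f] False by blast
  have ga: "g a > 0"
    using a(1) g_nonneg[of a] pos[of a] by force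
  \<comment> \<open>Since \<open>f b \<le> 0\<close>, this is positive, and on \<open>?N\<close> it
    gives \<open>f x + l * g x \<ge> f b + l * g a = 1\<close>.\<close>
  define l where "l = (1 - f b) / g a"
  have l: "l > 0" and la: "l * g a = 1 - f b"
    using ga b(1) by (auto simp: l_def)
  have "f x + l * g x \<ge> 0" if x: "x \<in> K" for x
  proof (cases "f x \<le> 0")
    case True
    then have "l * g a \<le> l * g x" and "f b \<le> f x"
      using a(2)[of x] b(2)[of x] x l by auto
    then show ?thesis using la by linarith
  next
    case False
    then show ?thesis using g_nonneg[OF x] l by (simp add: add_nonneg_nonneg)
  qed
  with l show ?thesis by blast
qed

lemma quadratic_form_add_scaleR:
  fixes Q B :: "real^'n^'n"
  shows "u \<bullet> ((Q + l *\<^sub>R B) *v u) = u \<bullet> (Q *v u) + l * (u \<bullet> (B *v u))"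
  by (simp add: matrix_vector_mult_add_rdistrib scaleR_matrix_vector_assoc[symmetric]
      inner_add_right)

lemma quadratic_form_scaleR:
  fixes M :: "real^'n^'n"
  shows "(c *\<^sub>R u) \<bullet> (M *v (c *\<^sub>R u)) = c\<^sup>2 * (u \<bullet> (M *v u))"
  by (simp add: matrix_vector_mult_scaleR power2_eq_square)

lemma continuous_on_quadratic_form:
  fixes M :: "real^'n^'n"
  shows "continuous_on S (\<lambda>u. u \<bullet> (M *v u))"
  by (intro continuous_intros matrix_vector_mult_linear_continuous_on)

text \<open>By homogeneity the form at \<open>u\<close> is the squared norm of \<open>u\<close>
  times its value at the unit vector \<open>sgn u\<close>.\<close>

lemma pos_semidefI_sphere:
  fixes M :: "real^'n^'n"
  assumes "symmetric_matrix M" and "\<And>u. u \<in> sphere 0 1 \<Longrightarrow> u \<bullet> (M *v u) \<ge> 0"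
  shows "pos_semidef M"
  unfolding pos_semidef_def
proof (intro conjI allI)
  fix u :: "real^'n"
  have "u \<bullet> (M *v u) = (norm u)\<^sup>2 * (sgn u \<bullet> (M *v sgn u))"
  proof -
    have "norm u *\<^sub>R sgn u = u" by (cases "u = 0") (simp_all add: sgn_div_norm)
    then show ?thesis using quadratic_form_scaleR[of "norm u" "sgn u" M] by simp
  qed
  moreover have "sgn u \<bullet> (M *v sgn u) \<ge> 0" if "u \<noteq> 0"
    using that assms(2)[of "sgn u"] by (simp add: norm_sgn)
  ultimately show "u \<bullet> (M *v u) \<ge> 0"
    by (cases "u = 0") auto
qed (rule assms(1))

lemma symmetric_matrix_add_scaleR:
  "symmetric_matrix Q \<Longrightarrow> symmetric_matrix B \<Longrightarrow> symmetric_matrix (Q + l *\<^sub>R B)"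
  by (simp add: symmetric_matrix_def transpose_def vec_eq_iff)

text \<open>Positivity of \<open>Q\<close> is required on the zero set of the form of
  \<open>B\<close>, which takes the place of the null space. The unit sphere omits 0, so
  \<open>pos\<close> supplies exactly the positivity that \<open>compact_penalty\<close> asks
  for.\<close>

lemma finsler:
  fixes Q B :: "real^'n^'n"
  assumes Q: "symmetric_matrix Q" and B: "pos_semidef B"
    and pos: "\<And>u. u \<noteq> 0 \<Longrightarrow> u \<bullet> (B *v u) = 0 \<Longrightarrow> u \<bullet> (Q *v u) > 0"
  shows "\<exists>l>0. pos_semidef (Q + l *\<^sub>R B)"
proof -
  have "\<exists>l>0. \<forall>u\<in>sphere 0 1. u \<bullet> (Q *v u) + l * (u \<bullet> (B *v u)) \<ge> 0"
    using B
    by (intro compact_penalty continuous_on_quadratic_form)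
      (auto simp: pos_semidef_def intro!: pos)
  then obtain l where "l > 0" and l: "\<forall>u\<in>sphere 0 1. u \<bullet> (Q *v u) + l * (u \<bullet> (B *v u)) \<ge> 0"
    by blast
  have "pos_semidef (Q + l *\<^sub>R B)"
    using l Q B symmetric_matrix_add_scaleR
    by (intro pos_semidefI_sphere) (auto simp: quadratic_form_add_scaleR pos_semidef_def)
  with \<open>l > 0\<close> show ?thesis by blast
qed

lemma quadratic_form_congruence:
  fixes A :: "real^'n^'p" and S :: "real^'p^'p"
  shows "u \<bullet> ((transpose A ** S ** A) *v u) = (A *v u) \<bullet> (S *v (A *v u))"
proof -
  \<comment> \<open>The transpose is the adjoint for the inner product; it is applied below with
    \<open>w = S *v (A *v u)\<close>.\<close>
  have "u \<bullet> (transpose A *v w) = (A *v u) \<bullet> w" for w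
    by (metis dot_lmul_matrix inner_commute transpose_matrix_vector)
  then show ?thesis
    by (simp only: matrix_vector_mul_assoc[symmetric])
qed

lemma pos_def_quadratic_form_eq_0_iff:
  "pos_def S \<Longrightarrow> v \<bullet> (S *v v) = 0 \<longleftrightarrow> v = 0"
  unfolding pos_def_def by (metis inner_zero_left less_irrefl)

lemma pos_semidef_congruence:
  fixes A :: "real^'n^'p" and S :: "real^'p^'p"
  assumes "pos_semidef S"
  shows "pos_semidef (transpose A ** S ** A)"
  using assms unfolding pos_semidef_def symmetric_matrix_def
  by (simp add: quadratic_form_congruence matrix_transpose_mul matrix_mul_assoc)

lemma pos_def_imp_pos_semidef: "pos_def S \<Longrightarrow> pos_semidef S"
  unfolding pos_def_def pos_semidef_def by (metis inner_zero_left less_eq_real_def)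

theorem proposition1:
  fixes A :: "real^'n^'p" and Q :: "real^'n^'n"
  assumes "full_rank A"
    and "symmetric_matrix Q"
    and "\<forall>u \<in> null_space A - {0}. u \<bullet> (Q *v u) > 0"
  shows "(\<forall>B :: real^'n^'n.
            pos_semidef B \<and> (\<forall>u. u \<bullet> (B *v u) = 0 \<longleftrightarrow> u \<in> null_space A)
            \<longrightarrow> (\<exists>l > 0. pos_semidef (Q + l *\<^sub>R B)))
       \<and> (\<forall>S :: real^'p^'p. pos_def S \<longrightarrow>
            (let B = transpose A ** S ** A in
              pos_semidef B \<and> (\<forall>u. u \<bullet> (B *v u) = 0 \<longleftrightarrow> u \<in> null_space A)
              \<and> (\<exists>l > 0. pos_semidef (Q + l *\<^sub>R B))))"
proof -
  have ex: "\<exists>l>0. pos_semidef (Q + l *\<^sub>R B)"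
    if "pos_semidef B" "\<forall>u. u \<bullet> (B *v u) = 0 \<longleftrightarrow> u \<in> null_space A" for B :: "real^'n^'n"
    using that assms(2,3) by (intro finsler) auto
  have psd: "pos_semidef (transpose A ** S ** A)"
    and null: "\<forall>u. u \<bullet> ((transpose A ** S ** A) *v u) = 0 \<longleftrightarrow> u \<in> null_space A"
    if "pos_def S" for S :: "real^'p^'p"
    using that
    by (simp_all add: pos_semidef_congruence pos_def_imp_pos_semidef quadratic_form_congruence
        pos_def_quadratic_form_eq_0_iff null_space_def)
  show ?thesis
    unfolding Let_def using ex psd null by blast
qed

end
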